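(* Let $X^*\in\mathbb{R}^{m\times p}$ and $\mathcal{T}_*:=\{i\in\{1,\dots,n\} : F_i(X^* )=0\}$. Suppose that the only vector $z=(z_i)_{i\in\mathcal{T}_*}\in\mathbb{R}^{|\mathcal{T}_*|}$ with $z\ge 0$ and $\sum_{i\in\mathcal{T}_*}z_iA_i=0$ is $z=0$. Then the following assertions hold. (i) If $X^*$ is a local minimizer of problem (P), then $0\in\partial(f+\lambda\varphi)(X^* )$, i.e. $-\nabla f(X^* )\in\lambda\,\partial\varphi(X^* )=\partial\varphi(X^* )$, and there exists $z^*\in\Lambda(X^*,-\nabla f(X^* ))$ such that $$\langle D,\nabla^2f(X^* )D\rangle\ge 0\quad\text{for all } D\in\{D\in\mathbb{R}^{m\times p} : z_i^*\langle D,A_i\rangle=0,\ \langle D,A_i\rangle\le 0,\ z_i^*\ge 0,\ i\in\mathcal{T}_*\}.$$ (ii) If $0\in\partial(f+\lambda\varphi)(X^* )$ and there exists $z^*\in\Lambda(X^*,-\nabla f(X^* ))$ such that $$\langle D,\nabla^2f(X^* )D\rangle> 0\quad\text{for all } D\in\{D\in\mathbb{R}^{m\times p} : z_i^*\langle D,A_i\rangle=0,\ \langle D,A_i\rangle\le 0,\ z_i^*\ge 0,\ i\in\mathcal{T}_*\}\setminus\{0\},$$ then $X^*$ is a local minimizer of problem (P) and the second-order growth condition holds at $X^*$: there exist $\kappa>0$ and $\delta>0$ such that for every $X\in B(X^*,\delta)$, $$f(X)+\lambda\|F(X)_+\|_0\ \ge\ f(X^* )+\lambda\|F(X^* )_+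\|_0+\kappa\|X-X^*\|_F^2.$$
   Context: Let $m,p,n$ be positive integers. $\mathbb{R}^{m\times p}$ carries the inner product $\langle X,Y\rangle=\mathrm{tr}(X^TY)$ and the Frobenius norm $\|\cdot\|_F$; $B(X^*,\delta)=\{X : \|X-X^*\|_F<\delta\}$. Let $f:\mathbb{R}^{m\times p}\to\mathbb{R}$ be twice continuously differentiable, $\lambda>0$, and $A_1,\dots,A_n\in\mathbb{R}^{m\times p}$. The Hessian acts by $[\nabla^2f(X)V]_{ij}=\sum_{k,l}\frac{\partial^2f(X)}{\partial X_{ij}\partial X_{kl}}V_{kl}$. The 0-1 loss is $\ell_{0/1}(t)=1$ if $t>0$ and $0$ if $t\le0$. For $y\in\mathbb{R}^n$, $\|y_+\|_0=\sum_{i=1}^n\ell_{0/1}(y_i)$ is the number of positive entries; write $g(y)=\|y_+\|_0$. Let $F(X)=(F_1(X),\dots,F_n(X))^T$ with $F_i(X)=1+\langle A_i,X\rangle$, and $\varphi(X)=\|F(X)_+\|_0$. For $z\in\mathbb{R}^n$ write $A^Tz=\sum_{i=1}^nz_iA_i$. Problem (P) is $\min_{X\in\mathbb{R}^{m\times p}} f(X)+\lambda\varphi(X)$. For a function $h$ on a Euclidean space, finite at $\bar x$, the regular subdifferential is $\hat\partial h(\bar x)=\{v : \liminf_{x\to\bar x}\frac{h(x)-h(\bar x)-\langle v,x-\bar x\rangle}{\|x-\bar x\|}\ge0\}$ and the limiting subdifferential is $\partial h(\bar x)=\{v : \exists\,x_k\to\bar x,\ h(x_k)\to h(\bar x),\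 v_k\in\hat\partial h(x_k),\ v_k\to v\}$. The notation $\partial\|F(X^* )_+\|_0$ means $\partial g(F(X^* ))\subset\mathbb{R}^n$, the limiting subdifferential of $g$ at the point $F(X^* )$. For $V\in\mathbb{R}^{m\times p}$, $\Lambda(X^*,V)=\{z\in\partial g(F(X^* )) : A^Tz=V\}$. *)

theory Defs
  imports "HOL-Analysis.Analysis"
begin

(* An m-by-p matrix has type real^'p^'m ('m indexes rows), and a family of n matrices is a
   function on the finite type 'n.  The library inner product and norm on real^'p^'m are the
   trace inner product and the Frobenius norm: *)

lemma inner_matrix_eq_trace:
  fixes X Y :: "real^'p^'m"
  shows "X \<bullet> Y = trace (transpose X ** Y)"
  unfolding inner_vec_def trace_def transpose_def matrix_matrix_mult_def
  by simp (rule sum.swap)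

lemma norm_matrix_eq_frobenius:
  fixes X :: "real^'p^'m"
  shows "norm X = sqrt (\<Sum>i\<in>UNIV. \<Sum>j\<in>UNIV. (X $ i $ j)\<^sup>2)"
  by (simp add: norm_eq_sqrt_inner inner_vec_def power2_eq_square)

definition twice_continuously_differentiable :: "('a::real_normed_vector \<Rightarrow> real) \<Rightarrow> bool" where
  "twice_continuously_differentiable f \<longleftrightarrow>
    (\<exists>(f' :: 'a \<Rightarrow> 'a \<Rightarrow>\<^sub>L real) (f'' :: 'a \<Rightarrow> 'a \<Rightarrow>\<^sub>L ('a \<Rightarrow>\<^sub>L real)).
      (\<forall>x. (f has_derivative blinfun_apply (f' x)) (at x)) \<and>
      (\<forall>x. (f' has_derivative blinfun_apply (f'' x)) (at x)) \<and>
      continuous_on UNIV f'')"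

definition matrix_unit :: "'m::finite \<Rightarrow> 'p::finite \<Rightarrow> real^'p^'m" where
  "matrix_unit i j = axis i (axis j 1)"

definition partial_deriv ::
  "'m::finite \<Rightarrow> 'p::finite \<Rightarrow> (real^'p^'m \<Rightarrow> real) \<Rightarrow> real^'p^'m \<Rightarrow> real" where
  "partial_deriv i j f X = deriv (\<lambda>t. f (X + t *\<^sub>R matrix_unit i j)) 0"

definition gradient :: "(real^'p::finite^'m::finite \<Rightarrow> real) \<Rightarrow> real^'p^'m \<Rightarrow> real^'p^'m" where
  "gradient f X = (\<chi> i j. partial_deriv i j f X)"

definition hessian ::
  "(real^'p::finite^'m::finite \<Rightarrow> real) \<Rightarrow> real^'p^'m \<Rightarrow> real^'p^'m \<Rightarrow> real^'p^'m" where
  "hessian f X V =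
    (\<chi> i j. \<Sum>k\<in>UNIV. \<Sum>l\<in>UNIV. partial_deriv i j (partial_deriv k l f) X * V $ k $ l)"

definition loss01 :: "real \<Rightarrow> real" where
  "loss01 t = (if t > 0 then 1 else 0)"

definition pos_count :: "real^'n \<Rightarrow> real" where
  "pos_count y = (\<Sum>i\<in>UNIV. loss01 (y $ i))"

definition affine_map :: "('n::finite \<Rightarrow> real^'p^'m) \<Rightarrow> real^'p^'m \<Rightarrow> real^'n" where
  "affine_map A X = (\<chi> i. 1 + A i \<bullet> X)"

definition adjoint_map :: "('n::finite \<Rightarrow> real^'p^'m) \<Rightarrow> real^'n \<Rightarrow> real^'p^'m" where
  "adjoint_map A z = (\<Sum>i\<in>UNIV. z $ i *\<^sub>R A i)"

definition phi :: "('n::finite \<Rightarrow> real^'p^'m) \<Rightarrow> real^'p^'m \<Rightarrow> real" where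
  "phi A X = pos_count (affine_map A X)"

(* The quotients are taken in ereal because their lower limit may be infinite. *)
definition regular_subdiff :: "('a::euclidean_space \<Rightarrow> real) \<Rightarrow> 'a \<Rightarrow> 'a set" where
  "regular_subdiff h x =
    {v. Liminf (at x) (\<lambda>y. ereal ((h y - h x - v \<bullet> (y - x)) / norm (y - x))) \<ge> 0}"

definition limiting_subdiff :: "('a::euclidean_space \<Rightarrow> real) \<Rightarrow> 'a \<Rightarrow> 'a set" where
  "limiting_subdiff h x =
    {v. \<exists>xs vs. xs \<longlonglongrightarrow> x \<and> (\<lambda>k. h (xs k)) \<longlonglongrightarrow> h x \<and>
          (\<forall>k::nat. vs k \<in> regular_subdiff h (xs k)) \<and> vs \<longlonglongrightarrow> v}"

definition multipliers :: "('n::finite \<Rightarrow> real^'p^'m) \<Rightarrow> real^'p^'m \<Rightarrow> real^'p^'m \<Rightarrow> (real^'n) set" where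
  "multipliers A X V = {z \<in> limiting_subdiff pos_count (affine_map A X). adjoint_map A z = V}"

definition active_set :: "('n::finite \<Rightarrow> real^'p^'m) \<Rightarrow> real^'p^'m \<Rightarrow> 'n set" where
  "active_set A X = {i. affine_map A X $ i = 0}"

definition critical_directions ::
  "('n::finite \<Rightarrow> real^'p^'m) \<Rightarrow> real^'p^'m \<Rightarrow> real^'n \<Rightarrow> (real^'p^'m) set" where
  "critical_directions A X z =
    {D. \<forall>i\<in>active_set A X. z $ i * (D \<bullet> A i) = 0 \<and> D \<bullet> A i \<le> 0 \<and> z $ i \<ge> 0}"

definition local_minimizer :: "('a::metric_space \<Rightarrow> real) \<Rightarrow> 'a \<Rightarrow> bool" where
  "local_minimizer h x \<longleftrightarrow> (\<exists>\<delta>>0. \<forall>y\<in>ball x \<delta>. h x \<le> h y)"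

end

theory Submission imports Defs begin

text \<open>
  Near a point \<open>X\<close> the count of positive \<open>F\<^sub>i\<close> is a step function: let \<open>K\<close> be the
  polyhedral cone of directions \<open>D\<close> with \<open>A i \<bullet> D \<le> 0\<close> for all active \<open>i\<close>.  On \<open>X + K\<close>
  the count keeps its value, and off \<open>X + K\<close> it jumps up by at least \<open>1\<close>
  (\<open>halfspace_count_near\<close>).  Everything follows from this dichotomy.

  The regular and the limiting subdifferential of the count both equal the polar cone of \<open>K\<close>
  (\<open>limiting_subdiff_halfspace_count\<close>), so that they are invariant under positive scaling; by
  Farkas' lemma the polar consists of the nonnegative combinations of the active \<open>A i\<close>, and a
  multiplier is precisely the coefficient vector of such a combination (\<open>multipliers_iff\<close>).

  Along short segments in the directions of \<open>K\<close> the objective differs from \<open>f\<close> by a constant.  A local minimizer therefore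
  minimizes \<open>f\<close> on each such segment; to first order this puts \<open>- gradient f\<close> into the polar of
  \<open>K\<close>, and to second order it makes the Hessian nonnegative on every \<open>D \<in> K\<close> with
  \<open>gradient f \<bullet> D = 0\<close>.  If \<open>z\<close> is a multiplier, then \<open>gradient f \<bullet> D\<close> is minus the sum of the
  terms \<open>z i * (A i \<bullet> D)\<close>, none of which is positive for \<open>D \<in> K\<close>.  It vanishes exactly when every
  term does, and so these \<open>D\<close> are the critical directions.

  Conversely, a Hessian that is positive on the nonzero critical directions gives \<open>f\<close> quadratic
  growth on \<open>X + K\<close>, by compactness of the unit sphere (\<open>second_order_growth_on_cone\<close>).  Off
  \<open>X + K\<close> the penalty has risen by at least \<open>lam\<close>, which near \<open>X\<close> outweighs the small change of
  \<open>f\<close> together with the quadratic term.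
\<close>

section \<open>Regular and limiting subgradients\<close>

lemma regular_subdiff_iff:
  "v \<in> regular_subdiff h x \<longleftrightarrow>
    (\<forall>\<epsilon>>0. \<forall>\<^sub>F y in at x. - \<epsilon> < (h y - h x - v \<bullet> (y - x)) / norm (y - x))"
proof -
  have "v \<in> regular_subdiff h x \<longleftrightarrow>
    (\<forall>c<0. \<forall>\<^sub>F y in at x. c < ereal ((h y - h x - v \<bullet> (y - x)) / norm (y - x)))"
    by (simp add: regular_subdiff_def le_Liminf_iff)
  also have "\<dots> \<longleftrightarrow>
    (\<forall>\<epsilon>>0. \<forall>\<^sub>F y in at x. - \<epsilon> < (h y - h x - v \<bullet> (y - x)) / norm (y - x))"
  proof safe
    fix \<epsilon> :: real
    assume *: "\<forall>c<0. \<forall>\<^sub>F y in at x. c < ereal ((h y - h x - v \<bullet> (y - x)) / norm (y - x))"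
      and "0 < \<epsilon>"
    then have "ereal (- \<epsilon>) < 0" by simp
    with * have "\<forall>\<^sub>F y in at x. ereal (- \<epsilon>) < ereal ((h y - h x - v \<bullet> (y - x)) / norm (y - x))"
      by blast
    then show "\<forall>\<^sub>F y in at x. - \<epsilon> < (h y - h x - v \<bullet> (y - x)) / norm (y - x)"
      by (rule eventually_mono) simp
  next
    fix c :: ereal
    assume *: "\<forall>\<epsilon>>0. \<forall>\<^sub>F y in at x. - \<epsilon> < (h y - h x - v \<bullet> (y - x)) / norm (y - x)"
      and "c < 0"
    obtain r where r: "c < ereal r" "r < 0"
      using ereal_dense2[OF \<open>c < 0\<close>] by auto
    have "\<forall>\<^sub>F y in at x. - (- r) < (h y - h x - v \<bullet> (y - x)) / norm (y - x)"
      using * r(2) by (metis neg_0_less_iff_less)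
    then show "\<forall>\<^sub>F y in at x. c < ereal ((h y - h x - v \<bullet> (y - x)) / norm (y - x))"
      by (rule eventually_mono) (use r in \<open>metis less_ereal.simps(1) less_trans minus_minus\<close>)
  qed
  finally show ?thesis .
qed

lemma regular_subdiff_subset_limiting_subdiff:
  "regular_subdiff h x \<subseteq> limiting_subdiff h x"
proof
  fix v assume "v \<in> regular_subdiff h x"
  then show "v \<in> limiting_subdiff h x"
    unfolding limiting_subdiff_def
    by (intro CollectI exI[of _ "\<lambda>_. x"] exI[of _ "\<lambda>_. v"]) auto
qed

lemma local_minimizer_eventually:
  assumes "local_minimizer h x"
  shows "\<forall>\<^sub>F y in nhds x. h x \<le> h y"
  using assms unfolding local_minimizer_def eventually_nhds_metric
  by (auto simp: dist_commute)

lemma local_minimizer_imp_zero_regular_subdiff: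
  assumes "local_minimizer h x"
  shows "0 \<in> regular_subdiff h x"
  unfolding regular_subdiff_iff
proof (intro allI impI)
  fix \<epsilon> :: real assume "\<epsilon> > 0"
  have "\<forall>\<^sub>F y in at x. h x \<le> h y"
    using local_minimizer_eventually[OF assms] by (simp add: eventually_at_filter eventually_mono)
  then show "\<forall>\<^sub>F y in at x. - \<epsilon> < (h y - h x - 0 \<bullet> (y - x)) / norm (y - x)"
  proof (rule eventually_mono)
    fix y assume "h x \<le> h y"
    then have "0 \<le> (h y - h x - 0 \<bullet> (y - x)) / norm (y - x)" by simp
    with \<open>\<epsilon> > 0\<close> show "- \<epsilon> < (h y - h x - 0 \<bullet> (y - x)) / norm (y - x)" by linarith
  qed
qed

lemma tendsto_ray_at_right:
  fixes x D :: "'a::real_normed_vector"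
  shows "((\<lambda>t. x + t *\<^sub>R D) \<longlongrightarrow> x) (at_right 0)"
proof -
  have "((\<lambda>t. x + t *\<^sub>R D) \<longlongrightarrow> x + 0 *\<^sub>R D) (at_right 0)"
    by (intro tendsto_intros)
  then show ?thesis by simp
qed

section \<open>Counting violated affine inequalities\<close>

text \<open>
  The setting of affine inequalities on a general Euclidean space covers both the penalty of the
  problem (with the constant \<open>1\<close> and the matrices \<open>A i\<close>) and \<open>pos_count\<close> itself (with the
  constant \<open>0\<close> and the coordinate vectors), so that both subdifferentials come from one
  computation.
\<close>

definition halfspace_count :: "('n::finite \<Rightarrow> real) \<Rightarrow> ('n \<Rightarrow> 'a::euclidean_space) \<Rightarrow> 'a \<Rightarrow> real" where
  "halfspace_count b a x = (\<Sum>i\<in>UNIV. loss01 (b i + a i \<bullet> x))"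

text \<open>
  The linearized cone of those inequalities \<open>b i + a i \<bullet> y \<le> 0\<close> that are active at \<open>x\<close>.  An
  inequality violated at \<open>x\<close> stays violated nearby, so it imposes nothing on directions.
\<close>

definition feasible_cone :: "('n::finite \<Rightarrow> real) \<Rightarrow> ('n \<Rightarrow> 'a::euclidean_space) \<Rightarrow> 'a \<Rightarrow> 'a set" where
  "feasible_cone b a x = {D. \<forall>i. b i + a i \<bullet> x = 0 \<longrightarrow> a i \<bullet> D \<le> 0}"

lemma inactive_sign_stable:
  fixes a :: "'n::finite \<Rightarrow> 'a::euclidean_space"
  shows "\<forall>\<^sub>F y in nhds x. \<forall>i. b i + a i \<bullet> x \<noteq> 0 \<longrightarrow> sgn (b i + a i \<bullet> y) = sgn (b i + a i \<bullet> x)"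
proof (rule eventually_all_finite)
  fix i
  have lim: "((\<lambda>y. b i + a i \<bullet> y) \<longlongrightarrow> b i + a i \<bullet> x) (nhds x)"
    by (intro tendsto_intros filterlim_ident)
  consider "b i + a i \<bullet> x = 0" | "b i + a i \<bullet> x > 0" | "b i + a i \<bullet> x < 0" by linarith
  then show "\<forall>\<^sub>F y in nhds x. b i + a i \<bullet> x \<noteq> 0 \<longrightarrow> sgn (b i + a i \<bullet> y) = sgn (b i + a i \<bullet> x)"
  proof cases
    case 1 then show ?thesis by simp
  next
    case 2
    from order_tendstoD(1)[OF lim 2] show ?thesis
      by (rule eventually_mono) (use 2 in simp)
  next
    case 3
    from order_tendstoD(2)[OF lim 3] show ?thesis
      by (rule eventually_mono) (use 3 in simp)
  qed
qed

text \<open>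
  Inactive terms keep their value near \<open>x\<close>, and active terms vanish at \<open>x\<close>.  Hence the count
  cannot decrease, and it increases as soon as one active function becomes positive.
\<close>

lemma halfspace_count_near:
  fixes a :: "'n::finite \<Rightarrow> 'a::euclidean_space"
  shows "\<forall>\<^sub>F y in nhds x.
    (y - x \<in> feasible_cone b a x \<longrightarrow> halfspace_count b a y = halfspace_count b a x) \<and>
    (y - x \<notin> feasible_cone b a x \<longrightarrow> halfspace_count b a y \<ge> halfspace_count b a x + 1)"
  using inactive_sign_stable[of b a x]
proof (rule eventually_mono)
  fix y
  assume stable: "\<forall>i. b i + a i \<bullet> x \<noteq> 0 \<longrightarrow> sgn (b i + a i \<bullet> y) = sgn (b i + a i \<bullet> x)"
  have inactive: "loss01 (b i + a i \<bullet> y) = loss01 (b i + a i \<bullet> x)" if "b i + a i \<bullet> x \<noteq> 0" for i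
    using stable[rule_format, OF that] that by (auto simp: loss01_def sgn_if split: if_splits)
  have active: "b i + a i \<bullet> y = a i \<bullet> (y - x)" if "b i + a i \<bullet> x = 0" for i
    using that by (simp add: inner_diff_right)
  have "halfspace_count b a y = halfspace_count b a x" if "y - x \<in> feasible_cone b a x"
    unfolding halfspace_count_def
  proof (rule sum.cong[OF refl])
    fix i
    show "loss01 (b i + a i \<bullet> y) = loss01 (b i + a i \<bullet> x)"
      using inactive[of i] active[of i] that
      by (cases "b i + a i \<bullet> x = 0") (auto simp: feasible_cone_def loss01_def)
  qed
  moreover have "halfspace_count b a y \<ge> halfspace_count b a x + 1"
    if "y - x \<notin> feasible_cone b a x"
  proof -
    obtain j where j: "b j + a j \<bullet> x = 0" "a j \<bullet> (y - x) > 0"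
      using \<open>y - x \<notin> feasible_cone b a x\<close> by (auto simp: feasible_cone_def not_le)
    have ge: "loss01 (b i + a i \<bullet> x) \<le> loss01 (b i + a i \<bullet> y)" for i
      using inactive[of i] by (cases "b i + a i \<bullet> x = 0") (auto simp: loss01_def)
    have "halfspace_count b a x = loss01 (b j + a j \<bullet> x) + (\<Sum>i\<in>UNIV - {j}. loss01 (b i + a i \<bullet> x))"
      unfolding halfspace_count_def by (simp add: sum.remove[of UNIV j])
    also have "\<dots> \<le> 0 + (\<Sum>i\<in>UNIV - {j}. loss01 (b i + a i \<bullet> y))"
      using j ge by (intro add_mono sum_mono) (auto simp: loss01_def)
    also have "\<dots> = halfspace_count b a y - 1"
      using j active[OF j(1)] unfolding halfspace_count_def
      by (simp add: sum.remove[of UNIV j] loss01_def)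
    finally show ?thesis by simp
  qed
  ultimately show "(y - x \<in> feasible_cone b a x \<longrightarrow> halfspace_count b a y = halfspace_count b a x) \<and>
    (y - x \<notin> feasible_cone b a x \<longrightarrow> halfspace_count b a y \<ge> halfspace_count b a x + 1)"
    by blast
qed

lemma feasible_cone_scaleR:
  assumes "D \<in> feasible_cone b a x" "t \<ge> 0"
  shows "t *\<^sub>R D \<in> feasible_cone b a x"
  using assms by (auto simp: feasible_cone_def mult_nonneg_nonpos)

lemma closed_feasible_cone: "closed (feasible_cone b a x)"
proof -
  have "feasible_cone b a x = (\<Inter>i\<in>{i. b i + a i \<bullet> x = 0}. {D. a i \<bullet> D \<le> 0})"
    by (auto simp: feasible_cone_def)
  then show ?thesis by (auto intro!: closed_INT closed_halfspace_le)
qed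

lemma halfspace_count_ray:
  assumes "D \<in> feasible_cone b a x"
  shows "\<forall>\<^sub>F t in at_right 0. halfspace_count b a (x + t *\<^sub>R D) = halfspace_count b a x"
proof -
  have "\<forall>\<^sub>F t in at_right 0. (x + t *\<^sub>R D - x \<in> feasible_cone b a x \<longrightarrow>
      halfspace_count b a (x + t *\<^sub>R D) = halfspace_count b a x)"
    using eventually_compose_filterlim[OF halfspace_count_near tendsto_ray_at_right]
    by (rule eventually_mono) blast
  moreover have "\<forall>\<^sub>F t in at_right 0. (t::real) > 0"
    by (simp add: eventually_at_right_less)
  ultimately show ?thesis
    by eventually_elim (use feasible_cone_scaleR[OF assms] in auto)
qed

text \<open>
  Near \<open>x\<close> the count is constant on feasible rays, so the subgradient inequality reduces to
  \<open>v \<bullet> D \<le> 0\<close>.  In the other directions it imposes nothing, because there the jump by \<open>1\<close>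
  beats the linear term \<open>v \<bullet> (y - x)\<close> near \<open>x\<close>.
\<close>

lemma regular_subdiff_halfspace_count:
  fixes a :: "'n::finite \<Rightarrow> 'a::euclidean_space"
  shows "regular_subdiff (halfspace_count b a) x = {v. \<forall>D\<in>feasible_cone b a x. v \<bullet> D \<le> 0}"
proof safe
  fix v D
  assume v: "v \<in> regular_subdiff (halfspace_count b a) x" and D: "D \<in> feasible_cone b a x"
  show "v \<bullet> D \<le> 0"
  proof (cases "D = 0")
    case False
    have "v \<bullet> D / norm D \<le> \<epsilon>" if "\<epsilon> > 0" for \<epsilon>
    proof -
      have ray: "filterlim (\<lambda>t. x + t *\<^sub>R D) (at x) (at_right 0)"
        unfolding filterlim_at using False tendsto_ray_at_right
        by (auto simp: eventually_at_filter)
      have "\<forall>\<^sub>F t in at_right 0. - \<epsilon> < (halfspace_count b a (x + t *\<^sub>R D) - halfspace_count b a x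
          - v \<bullet> (x + t *\<^sub>R D - x)) / norm (x + t *\<^sub>R D - x)"
        using eventually_compose_filterlim[OF _ ray] v that unfolding regular_subdiff_iff by blast
      moreover have "\<forall>\<^sub>F t in at_right 0. (t::real) > 0"
        by (simp add: eventually_at_right_less)
      ultimately have "\<forall>\<^sub>F t in at_right (0::real). v \<bullet> D / norm D \<le> \<epsilon>"
        using halfspace_count_ray[OF D]
        by eventually_elim (auto simp: False)
      then show ?thesis by (simp add: eventually_const_iff)
    qed
    then have "v \<bullet> D / norm D \<le> 0" by (rule field_le_epsilon[of _ 0, simplified])
    with False show ?thesis by (simp add: divide_le_0_iff)
  qed simp
next
  fix v
  assume v: "\<forall>D\<in>feasible_cone b a x. v \<bullet> D \<le> 0"
  have "((\<lambda>y. v \<bullet> (y - x)) \<longlongrightarrow> v \<bullet> (x - x)) (nhds x)"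
    by (intro tendsto_intros filterlim_ident)
  then have "\<forall>\<^sub>F y in nhds x. v \<bullet> (y - x) < 1"
    by (rule order_tendstoD) simp
  then have "\<forall>\<^sub>F y in nhds x. 0 \<le> halfspace_count b a y - halfspace_count b a x - v \<bullet> (y - x)"
    using halfspace_count_near[of x b a] 
    by eventually_elim (use v in \<open>smt (verit)\<close>)
  then have ev: "\<forall>\<^sub>F y in at x. 0 \<le> halfspace_count b a y - halfspace_count b a x - v \<bullet> (y - x)"
    by (simp add: eventually_at_filter eventually_mono)
  show "v \<in> regular_subdiff (halfspace_count b a) x"
    unfolding regular_subdiff_iff
  proof (intro allI impI)
    fix \<epsilon> :: real assume "\<epsilon> > 0"
    from ev show "\<forall>\<^sub>F y in at x. - \<epsilon> <
        (halfspace_count b a y - halfspace_count b a x - v \<bullet> (y - x)) / norm (y - x)"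
    proof (rule eventually_mono)
      fix y assume "0 \<le> halfspace_count b a y - halfspace_count b a x - v \<bullet> (y - x)"
      then have "0 \<le> (halfspace_count b a y - halfspace_count b a x - v \<bullet> (y - x)) / norm (y - x)"
        by simp
      with \<open>\<epsilon> > 0\<close> show "- \<epsilon> <
        (halfspace_count b a y - halfspace_count b a x - v \<bullet> (y - x)) / norm (y - x)" by linarith
    qed
  qed
qed

text \<open>
  Passing to the limit adds no subgradients: the active set can only shrink near \<open>x\<close>, so the
  feasible cones at nearby points contain the one at \<open>x\<close>, their polars lie in the polar at \<open>x\<close>,
  and this polar is closed.
\<close>

lemma limiting_subdiff_halfspace_count:
  fixes a :: "'n::finite \<Rightarrow> 'a::euclidean_space"
  shows "limiting_subdiff (halfspace_count b a) x = {v. \<forall>D\<in>feasible_cone b a x. v \<bullet> D \<le> 0}"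
proof
  show "{v. \<forall>D\<in>feasible_cone b a x. v \<bullet> D \<le> 0} \<subseteq> limiting_subdiff (halfspace_count b a) x"
    using regular_subdiff_subset_limiting_subdiff regular_subdiff_halfspace_count by blast
next
  show "limiting_subdiff (halfspace_count b a) x \<subseteq> {v. \<forall>D\<in>feasible_cone b a x. v \<bullet> D \<le> 0}"
  proof safe
    fix v D
    assume "v \<in> limiting_subdiff (halfspace_count b a) x" and D: "D \<in> feasible_cone b a x"
    then obtain xs vs where xs: "xs \<longlonglongrightarrow> x" and vs: "vs \<longlonglongrightarrow> v"
      and reg: "\<And>k. vs k \<in> regular_subdiff (halfspace_count b a) (xs k)"
      unfolding limiting_subdiff_def by blast
    have "\<forall>\<^sub>F k in sequentially. vs k \<bullet> D \<le> 0"
      using eventually_compose_filterlim[OF inactive_sign_stable[of b a x] xs]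
    proof eventually_elim
      case (elim k)
      have "D \<in> feasible_cone b a (xs k)"
        using D elim unfolding feasible_cone_def mem_Collect_eq by (metis sgn_0_0)
      then show ?case
        using reg[of k] unfolding regular_subdiff_halfspace_count by blast
    qed
    moreover have "(\<lambda>k. vs k \<bullet> D) \<longlonglongrightarrow> v \<bullet> D"
      by (intro tendsto_intros vs)
    ultimately show "v \<bullet> D \<le> 0"
      by (intro tendsto_upperbound[of "\<lambda>k. vs k \<bullet> D"]) auto
  qed
qed

section \<open>Farkas lemma for a finite family\<close>

text \<open>
  A finitely generated cone is closed, so a point outside it can be separated from it.  The
  separating functional, with its sign changed, is a direction that contradicts the polarity
  assumption.
\<close>

lemma farkas_finite_family:
  fixes a :: "'i \<Rightarrow> 'a::euclidean_space"
  assumes "finite T" and polar: "\<And>D. (\<And>i. i \<in> T \<Longrightarrow> a i \<bullet> D \<le> 0) \<Longrightarrow> v \<bullet> D \<le> 0"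
  obtains z where "\<And>i. i \<in> T \<Longrightarrow> 0 \<le> z i" "v = (\<Sum>i\<in>T. z i *\<^sub>R a i)"
proof -
  define K where "K = {(\<Sum>i\<in>T. z i *\<^sub>R a i) | z. \<forall>i\<in>T. (0::real) \<le> z i}"
  have "convex_cone K"
    unfolding convex_cone_iff
  proof (intro conjI allI ballI impI)
    show "0 \<in> K" unfolding K_def by (intro CollectI exI[of _ "\<lambda>_. 0"]) simp
  next
    fix u w assume "u \<in> K" "w \<in> K"
    then obtain y z where "\<forall>i\<in>T. 0 \<le> y i" "\<forall>i\<in>T. 0 \<le> z i"
      "u = (\<Sum>i\<in>T. y i *\<^sub>R a i)" "w = (\<Sum>i\<in>T. z i *\<^sub>R a i)" unfolding K_def by blast
    then show "u + w \<in> K"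
      unfolding K_def
      by (intro CollectI exI[of _ "\<lambda>i. y i + z i"]) (simp add: scaleR_left_distrib sum.distrib)
  next
    fix u and c :: real assume "u \<in> K" "c \<ge> 0"
    then obtain y where "\<forall>i\<in>T. 0 \<le> y i" "u = (\<Sum>i\<in>T. y i *\<^sub>R a i)" unfolding K_def by blast
    with \<open>c \<ge> 0\<close> show "c *\<^sub>R u \<in> K"
      unfolding K_def
      by (intro CollectI exI[of _ "\<lambda>i. c * y i"]) (simp add: scaleR_sum_right)
  qed
  moreover have "a ` T \<subseteq> K"
  proof
    fix u assume "u \<in> a ` T"
    then obtain j where j: "j \<in> T" "u = a j" by blast
    have "(\<Sum>i\<in>T. (if i = j then 1 else 0) *\<^sub>R a i) = (\<Sum>i\<in>T. if i = j then a i else 0)"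
      by (intro sum.cong) auto
    with j \<open>finite T\<close> have "u = (\<Sum>i\<in>T. (if i = j then 1 else 0) *\<^sub>R a i)"
      by simp
    then show "u \<in> K" unfolding K_def
      by (intro CollectI exI[of _ "\<lambda>i. if i = j then 1 else 0"]) simp
  qed
  ultimately have hull: "convex_cone hull (a ` T) \<subseteq> K"
    by (simp add: hull_minimal)
  have "v \<in> convex_cone hull (a ` T)"
  proof (rule ccontr)
    assume "v \<notin> convex_cone hull (a ` T)"
    moreover have "closed (convex_cone hull (a ` T))"
      using \<open>finite T\<close> by (intro closed_convex_cone_hull) simp
    ultimately obtain p \<beta> where v: "p \<bullet> v < \<beta>"
      and sep: "\<And>u. u \<in> convex_cone hull (a ` T) \<Longrightarrow> p \<bullet> u > \<beta>"
      using separating_hyperplane_closed_point[OF convex_convex_cone_hull] by blast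
    have "\<beta> < 0" using sep[OF convex_cone_hull_contains_0] by simp
    have "a i \<bullet> (- p) \<le> 0" if "i \<in> T" for i
    proof (rule ccontr)
      assume "\<not> a i \<bullet> (- p) \<le> 0"
      then have neg: "p \<bullet> a i < 0" by (simp add: inner_commute)
      \<comment> \<open>scaling \<open>a i\<close> until the separating functional takes the value \<open>\<beta>\<close> leaves the half-space\<close>
      have "(\<beta> / (p \<bullet> a i)) *\<^sub>R a i \<in> convex_cone hull (a ` T)"
        using that neg \<open>\<beta> < 0\<close>
        by (intro convex_cone_hull_mul hull_inc) (auto intro: divide_nonpos_neg)
      from sep[OF this] neg show False by simp
    qed
    then have "v \<bullet> (- p) \<le> 0" by (rule polar)
    with v \<open>\<beta> < 0\<close> show False by (simp add: inner_commute)
  qed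
  with hull obtain z where "\<forall>i\<in>T. 0 \<le> z i" "v = (\<Sum>i\<in>T. z i *\<^sub>R a i)"
    unfolding K_def by blast
  then show thesis using that by blast
qed

section \<open>Second-order conditions along a cone\<close>

text \<open>
  The mean value theorem is applied to the remainder on the segment from \<open>x\<close> to \<open>x + h\<close>, as a
  function of one real variable.  Its derivative at \<open>s\<close> is the error of the linear approximation
  \<open>f' x + f2 (s *\<^sub>R h)\<close> to \<open>f' (x + s *\<^sub>R h)\<close>, evaluated at \<open>h\<close>, and differentiability of \<open>f'\<close> at
  \<open>x\<close> makes this small compared with the square of \<open>norm h\<close>.
\<close>

lemma taylor_second_order:
  fixes f :: "'a::real_normed_vector \<Rightarrow> real" and f' :: "'a \<Rightarrow> 'a \<Rightarrow>\<^sub>L real"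
    and f2 :: "'a \<Rightarrow>\<^sub>L ('a \<Rightarrow>\<^sub>L real)"
  assumes f': "\<And>y. (f has_derivative blinfun_apply (f' y)) (at y)"
    and f2: "(f' has_derivative blinfun_apply f2) (at x)"
  shows "((\<lambda>h. (f (x + h) - f x - f' x h - f2 h h / 2) / (norm h)\<^sup>2) \<longlongrightarrow> 0) (at 0)"
proof (rule tendstoI)
  fix \<epsilon> :: real assume "\<epsilon> > 0"
  then obtain \<delta> where "\<delta> > 0"
    and \<delta>: "\<And>y. norm (y - x) < \<delta> \<Longrightarrow> norm (f' y - f' x - f2 (y - x)) \<le> \<epsilon> / 2 * norm (y - x)"
    using f2 unfolding has_derivative_at_alt by (meson half_gt_zero)
  have "dist ((f (x + h) - f x - f' x h - f2 h h / 2) / (norm h)\<^sup>2) 0 < \<epsilon>"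
    if "h \<noteq> 0" "norm h < \<delta>" for h
  proof -
    define r where "r = (\<lambda>s. f (x + s *\<^sub>R h) - s * f' x h - s\<^sup>2 / 2 * f2 h h)"
    have der: "(r has_derivative (\<lambda>t. t * (f' (x + s *\<^sub>R h) h - f' x h - s * f2 h h))) (at s)" for s
    proof -
      have "((\<lambda>s. x + s *\<^sub>R h) has_derivative (\<lambda>t. t *\<^sub>R h)) (at s)"
        by (auto intro!: derivative_eq_intros)
      from has_derivative_compose[OF this f']
      have "((\<lambda>s. f (x + s *\<^sub>R h)) has_derivative (\<lambda>t. t * f' (x + s *\<^sub>R h) h)) (at s)"
        by (simp add: blinfun.scaleR_right)
      then show ?thesis
        unfolding r_def
        by (auto intro!: derivative_eq_intros simp: field_simps power2_eq_square)
    qed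
    obtain s where s: "s \<in> {0<..<1}" "r 1 - r 0 = 1 * (f' (x + s *\<^sub>R h) h - f' x h - s * f2 h h)"
      using mvt_simple[of 0 1 r, OF _ has_derivative_at_withinI[OF der]] by auto
    have "norm (s *\<^sub>R h) < \<delta>"
      using s(1) that(2) mult_left_le_one_le[of "norm h" s] by auto
    then have "norm (f' (x + s *\<^sub>R h) - f' x - f2 (s *\<^sub>R h)) \<le> \<epsilon> / 2 * norm (s *\<^sub>R h)"
      using \<delta>[of "x + s *\<^sub>R h"] by simp
    also have "\<dots> \<le> \<epsilon> / 2 * norm h"
      using s(1) \<open>\<epsilon> > 0\<close> by (simp add: mult_left_le_one_le)
    finally have "norm (f' (x + s *\<^sub>R h) - f' x - f2 (s *\<^sub>R h)) * norm h \<le> \<epsilon> / 2 * norm h * norm h"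
      by (rule mult_right_mono) simp
    moreover have "norm ((f' (x + s *\<^sub>R h) - f' x - f2 (s *\<^sub>R h)) h) \<le>
        norm (f' (x + s *\<^sub>R h) - f' x - f2 (s *\<^sub>R h)) * norm h"
      by (rule norm_blinfun)
    moreover have "r 1 - r 0 = (f' (x + s *\<^sub>R h) - f' x - f2 (s *\<^sub>R h)) h"
      using s(2) by (simp add: blinfun.diff_left blinfun.scaleR_right blinfun.scaleR_left)
    ultimately have "norm (r 1 - r 0) \<le> \<epsilon> / 2 * (norm h)\<^sup>2"
      by (simp add: power2_eq_square algebra_simps)
    then have "norm (f (x + h) - f x - f' x h - f2 h h / 2) \<le> \<epsilon> / 2 * (norm h)\<^sup>2"
      by (simp add: r_def algebra_simps)
    then have "norm (f (x + h) - f x - f' x h - f2 h h / 2) / (norm h)\<^sup>2 \<le> \<epsilon> / 2"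
      using that by (simp add: divide_le_eq)
    then have "norm (f (x + h) - f x - f' x h - f2 h h / 2) / (norm h)\<^sup>2 < \<epsilon>"
      using \<open>\<epsilon> > 0\<close> by linarith
    then show ?thesis by simp
  qed
  with \<open>\<delta> > 0\<close> show "\<forall>\<^sub>F h in at 0. dist ((f (x + h) - f x - f' x h - f2 h h / 2) / (norm h)\<^sup>2) 0 < \<epsilon>"
    unfolding eventually_at by (auto simp: dist_norm)
qed

lemma first_order_necessary:
  fixes f :: "'a::real_normed_vector \<Rightarrow> real"
  assumes f': "(f has_derivative f') (at x)"
    and min: "\<forall>\<^sub>F t in at_right 0. f x \<le> f (x + t *\<^sub>R D)"
  shows "0 \<le> f' D"
proof -
  interpret bounded_linear f' by (rule has_derivative_bounded_linear[OF f'])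
  have "((\<lambda>t. x + t *\<^sub>R D) has_derivative (\<lambda>t. t *\<^sub>R D)) (at 0)"
    by (auto intro!: derivative_eq_intros)
  from has_derivative_compose[OF this, of f f'] f'
  have "((\<lambda>t. f (x + t *\<^sub>R D)) has_derivative (\<lambda>t. t * f' D)) (at 0)"
    by (simp add: scaleR)
  then have "((\<lambda>t. f (x + t *\<^sub>R D)) has_field_derivative f' D) (at 0)"
    by (simp add: has_field_derivative_def mult_commute_abs)
  then have "((\<lambda>t. (f (x + t *\<^sub>R D) - f x) / t) \<longlongrightarrow> f' D) (at_right 0)"
    by (auto simp: has_field_derivative_iff intro: filterlim_mono[OF _ order_refl at_le])
  moreover have "\<forall>\<^sub>F t in at_right 0. (t::real) > 0"
    by (simp add: eventually_at_right_less)
  with min have "\<forall>\<^sub>F t in at_right 0. 0 \<le> (f (x + t *\<^sub>R D) - f x) / t"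
    by eventually_elim simp
  ultimately show ?thesis
    by (intro tendsto_lowerbound) auto
qed

lemma second_order_necessary:
  fixes f :: "'a::real_normed_vector \<Rightarrow> real" and f' :: "'a \<Rightarrow> 'a \<Rightarrow>\<^sub>L real"
    and f2 :: "'a \<Rightarrow>\<^sub>L ('a \<Rightarrow>\<^sub>L real)"
  assumes f': "\<And>y. (f has_derivative blinfun_apply (f' y)) (at y)"
    and f2: "(f' has_derivative blinfun_apply f2) (at x)"
    and min: "\<forall>\<^sub>F t in at_right 0. f x \<le> f (x + t *\<^sub>R D)"
    and stationary: "f' x D = 0"
  shows "0 \<le> f2 D D"
proof (cases "D = 0")
  case False
  define \<rho> where "\<rho> = (\<lambda>h. (f (x + h) - f x - f' x h - f2 h h / 2) / (norm h)\<^sup>2)"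
  have pos: "\<forall>\<^sub>F t in at_right 0. (t::real) > 0"
    by (simp add: eventually_at_right_less)
  have "filterlim (\<lambda>t. t *\<^sub>R D) (at 0) (at_right 0)"
    unfolding filterlim_at
  proof
    show "\<forall>\<^sub>F t in at_right 0. t *\<^sub>R D \<in> UNIV \<and> t *\<^sub>R D \<noteq> 0"
      using pos by eventually_elim (simp add: False)
    show "((\<lambda>t. t *\<^sub>R D) \<longlongrightarrow> 0) (at_right 0)"
      using tendsto_ray_at_right[of 0 D] by simp
  qed
  then have "((\<lambda>t. \<rho> (t *\<^sub>R D)) \<longlongrightarrow> 0) (at_right 0)"
    using filterlim_compose[OF taylor_second_order[OF f' f2]] unfolding \<rho>_def by blast
  then have "((\<lambda>t. f2 D D / 2 + \<rho> (t *\<^sub>R D) * (norm D)\<^sup>2) \<longlongrightarrow> f2 D D / 2 + 0 * (norm D)\<^sup>2) (at_right 0)"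
    by (intro tendsto_intros)
  moreover have "\<forall>\<^sub>F t in at_right 0. 0 \<le> f2 D D / 2 + \<rho> (t *\<^sub>R D) * (norm D)\<^sup>2"
    using min pos
  proof eventually_elim
    case (elim t)
    have "f2 D D / 2 + \<rho> (t *\<^sub>R D) * (norm D)\<^sup>2 = (f (x + t *\<^sub>R D) - f x) / t\<^sup>2"
      using elim(2) False stationary
      by (simp add: \<rho>_def blinfun.scaleR_right blinfun.scaleR_left field_simps power2_eq_square)
    with elim show ?case by simp
  qed
  ultimately have "0 \<le> f2 D D / 2 + 0 * (norm D)\<^sup>2"
    by (intro tendsto_lowerbound) auto
  then show ?thesis by simp
qed (simp add: blinfun.zero_right)

text \<open>
  If growth failed for every constant, there would be points \<open>x + h n\<close> with \<open>h n \<in> K\<close> tending to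
  \<open>0\<close> and arbitrarily small quadratic growth.  A limit \<open>D\<close> of the normalized \<open>h n\<close> lies in \<open>K\<close>
  by compactness.  Taylor's formula divided by \<open>norm (h n)\<close> gives \<open>f' x D \<le> 0\<close>; divided by its
  square, with the nonnegative first-order term dropped, it gives \<open>f2 D D \<le> 0\<close>.
\<close>

lemma second_order_growth_on_cone:
  fixes f :: "'a::euclidean_space \<Rightarrow> real" and f' :: "'a \<Rightarrow> 'a \<Rightarrow>\<^sub>L real"
    and f2 :: "'a \<Rightarrow>\<^sub>L ('a \<Rightarrow>\<^sub>L real)"
  assumes f': "\<And>y. (f has_derivative blinfun_apply (f' y)) (at y)"
    and f2: "(f' has_derivative blinfun_apply f2) (at x)"
    and "closed K" and cone: "\<And>D t. D \<in> K \<Longrightarrow> 0 \<le> t \<Longrightarrow> t *\<^sub>R D \<in> K"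
    and first: "\<And>D. D \<in> K \<Longrightarrow> 0 \<le> f' x D"
    and second: "\<And>D. D \<in> K \<Longrightarrow> f' x D = 0 \<Longrightarrow> D \<noteq> 0 \<Longrightarrow> 0 < f2 D D"
  shows "\<exists>\<kappa>>0. \<forall>\<^sub>F y in nhds x. y - x \<in> K \<longrightarrow> f x + \<kappa> * (norm (y - x))\<^sup>2 \<le> f y"
proof (rule ccontr)
  assume contra: "\<not> ?thesis"
  define e where "e = (\<lambda>n. 1 / real (Suc n))"
  have e: "e n > 0" for n by (simp add: e_def)
  have e0: "e \<longlonglongrightarrow> 0" unfolding e_def by (rule LIMSEQ_Suc[OF lim_1_over_n])
  have "\<exists>h\<in>K. norm h < e n \<and> f (x + h) < f x + e n * (norm h)\<^sup>2" for n
  proof -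
    have "\<not> (\<forall>\<^sub>F y in nhds x. y - x \<in> K \<longrightarrow> f x + e n * (norm (y - x))\<^sup>2 \<le> f y)"
      using contra e by blast
    then obtain y where "dist y x < e n" "y - x \<in> K" "f y < f x + e n * (norm (y - x))\<^sup>2"
      unfolding eventually_nhds_metric using e[of n] by (meson not_le)
    then show ?thesis by (intro bexI[of _ "y - x"]) (auto simp: dist_norm)
  qed
  then obtain h where hK: "\<And>n. h n \<in> K" and h_small: "\<And>n. norm (h n) < e n"
    and h_low: "\<And>n. f (x + h n) < f x + e n * (norm (h n))\<^sup>2"
    by metis
  have h_nz: "h n \<noteq> 0" for n using h_low[of n] by auto
  have h0: "h \<longlonglongrightarrow> 0"
    by (rule Lim_null_comparison[OF _ e0]) (simp add: h_small less_imp_le)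
  define u where "u = (\<lambda>n. h n /\<^sub>R norm (h n))"
  have "u n \<in> K \<inter> sphere 0 1" for n
    using cone[OF hK[of n], of "inverse (norm (h n))"] h_nz[of n] by (simp add: u_def)
  moreover have "compact (K \<inter> sphere 0 1)"
    using \<open>closed K\<close> by (intro closed_Int_compact) auto
  ultimately obtain D r where D: "D \<in> K \<inter> sphere 0 1" and r: "strict_mono r"
    and lim: "(u \<circ> r) \<longlonglongrightarrow> D"
    unfolding compact_def by blast
  define \<rho> where "\<rho> = (\<lambda>h. (f (x + h) - f x - f' x h - f2 h h / 2) / (norm h)\<^sup>2)"
  have \<rho>0: "(\<lambda>n. \<rho> (h n)) \<longlonglongrightarrow> 0"
    unfolding \<rho>_def
    by (rule filterlim_compose[OF taylor_second_order[OF f' f2]]) (simp add: filterlim_at h0 h_nz)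
  have ineq: "f' x (u n) + norm (h n) * (f2 (u n) (u n) / 2) < norm (h n) * (e n - \<rho> (h n))" for n
  proof -
    define c where "c = norm (h n)"
    have c: "c > 0" using h_nz[of n] by (simp add: c_def)
    have hu: "h n = c *\<^sub>R u n" using h_nz[of n] by (simp add: u_def c_def)
    have "f (x + h n) - f x = f' x (h n) + f2 (h n) (h n) / 2 + \<rho> (h n) * c\<^sup>2"
      using c by (simp add: \<rho>_def c_def)
    also have "\<dots> = c * f' x (u n) + c\<^sup>2 * (f2 (u n) (u n) / 2) + \<rho> (h n) * c\<^sup>2"
      by (subst (1 2 3) hu) (simp add: blinfun.scaleR_right blinfun.scaleR_left power2_eq_square)
    finally have "c * (f' x (u n) + c * (f2 (u n) (u n) / 2)) < c * (c * (e n - \<rho> (h n)))"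
      using h_low[of n] by (simp add: c_def[symmetric] power2_eq_square algebra_simps)
    then show ?thesis using c by (simp add: c_def[symmetric])
  qed
  have sub: "(\<lambda>n. e (r n)) \<longlonglongrightarrow> 0" "(\<lambda>n. h (r n)) \<longlonglongrightarrow> 0" "(\<lambda>n. \<rho> (h (r n))) \<longlonglongrightarrow> 0" "(\<lambda>n. u (r n)) \<longlonglongrightarrow> D"
    using LIMSEQ_subseq_LIMSEQ[OF _ r] e0 h0 \<rho>0 lim by (auto simp: o_def)
  have "(\<lambda>n. f' x (u (r n)) + norm (h (r n)) * (f2 (u (r n)) (u (r n)) / 2)) \<longlonglongrightarrow>
      f' x D + norm (0::'a) * (f2 D D / 2)"
    by (intro tendsto_intros sub) auto
  moreover have "(\<lambda>n. norm (h (r n)) * (e (r n) - \<rho> (h (r n)))) \<longlonglongrightarrow> norm (0::'a) * (0 - 0)"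
    by (intro tendsto_intros sub)
  ultimately have "f' x D + norm (0::'a) * (f2 D D / 2) \<le> norm (0::'a) * (0 - 0)"
    by (rule LIMSEQ_le) (use ineq less_imp_le in blast)
  with first D have "f' x D = 0" by force
  have "f2 (u n) (u n) / 2 \<le> e n - \<rho> (h n)" for n
  proof -
    have "u n \<in> K" using cone[OF hK[of n], of "inverse (norm (h n))"] by (simp add: u_def)
    then have "norm (h n) * (f2 (u n) (u n) / 2) < norm (h n) * (e n - \<rho> (h n))"
      using first[of "u n"] ineq[of n] by linarith
    then show ?thesis using h_nz[of n] mult_less_cancel_left_pos[of "norm (h n)"] by fastforce
  qed
  moreover have "(\<lambda>n. f2 (u (r n)) (u (r n)) / 2) \<longlonglongrightarrow> f2 D D / 2"
    by (intro tendsto_intros sub) auto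
  moreover have "(\<lambda>n. e (r n) - \<rho> (h (r n))) \<longlonglongrightarrow> 0 - 0"
    by (intro tendsto_intros sub)
  ultimately have "f2 D D / 2 \<le> 0 - 0"
    by (intro LIMSEQ_le) blast+
  moreover have "D \<noteq> 0" using D by auto
  ultimately show False
    using second[of D] D \<open>f' x D = 0\<close> by simp
qed

section \<open>Gradient and Hessian in matrix coordinates\<close>

lemma matrix_unit_expansion:
  fixes V :: "real^'p::finite^'m::finite"
  shows "V = (\<Sum>i\<in>UNIV. \<Sum>j\<in>UNIV. V $ i $ j *\<^sub>R matrix_unit i j)"
proof -
  have unit: "matrix_unit i j $ k $ l = (if j = l then if i = k then 1 else 0 else 0)"
    for i k :: 'm and j l :: 'p
    by (simp add: matrix_unit_def axis_def)
  have "(\<Sum>i\<in>UNIV. \<Sum>j\<in>UNIV. V $ i $ j *\<^sub>R matrix_unit i j) $ k $ l = V $ k $ l" for k l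
    by (simp add: unit if_distrib[of "(*) _"] cong: if_cong)
  then show ?thesis by (simp add: vec_eq_iff)
qed

lemma blinfun_matrix_unit_sum:
  fixes L :: "(real^'p::finite^'m::finite) \<Rightarrow>\<^sub>L 'b::real_normed_vector"
  shows "(\<Sum>i\<in>UNIV. \<Sum>j\<in>UNIV. V $ i $ j *\<^sub>R L (matrix_unit i j)) = L V"
  by (subst (2) matrix_unit_expansion[of V]) (simp add: blinfun.sum_right blinfun.scaleR_right)

lemma partial_deriv_eq:
  assumes "(f has_derivative L) (at X)"
  shows "partial_deriv i j f X = L (matrix_unit i j)"
proof -
  interpret bounded_linear L by (rule has_derivative_bounded_linear[OF assms])
  have "((\<lambda>t. X + t *\<^sub>R matrix_unit i j) has_derivative (\<lambda>t. t *\<^sub>R matrix_unit i j)) (at 0)"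
    by (auto intro!: derivative_eq_intros)
  from has_derivative_compose[OF this, of f L] assms
  have "((\<lambda>t. f (X + t *\<^sub>R matrix_unit i j)) has_derivative (\<lambda>t. t * L (matrix_unit i j))) (at 0)"
    by (simp add: scaleR)
  then show ?thesis
    unfolding partial_deriv_def
    by (intro DERIV_imp_deriv) (simp add: has_field_derivative_def mult_commute_abs)
qed

lemma inner_gradient:
  fixes f' :: "(real^'p::finite^'m::finite) \<Rightarrow>\<^sub>L real"
  assumes "(f has_derivative blinfun_apply f') (at X)"
  shows "gradient f X \<bullet> D = f' D"
  by (subst blinfun_matrix_unit_sum[of D, symmetric])
    (simp add: inner_vec_def gradient_def partial_deriv_eq[OF assms] mult.commute)

text \<open>
  The order of the two partial derivatives in \<open>hessian\<close> is the order of the arguments of \<open>f2\<close>: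
  the outer derivative is taken in the direction contracted with \<open>D\<close>.
\<close>

lemma inner_hessian:
  fixes f' :: "real^'p::finite^'m::finite \<Rightarrow> (real^'p^'m) \<Rightarrow>\<^sub>L real"
    and f2 :: "(real^'p^'m) \<Rightarrow>\<^sub>L ((real^'p^'m) \<Rightarrow>\<^sub>L real)"
  assumes f': "\<And>Y. (f has_derivative blinfun_apply (f' Y)) (at Y)"
    and f2: "(f' has_derivative blinfun_apply f2) (at X)"
  shows "D \<bullet> hessian f X V = f2 D V"
proof -
  have entry: "((\<lambda>Y. f' Y (matrix_unit k l)) has_derivative (\<lambda>W. f2 W (matrix_unit k l))) (at X)" for k l
    by (rule bounded_linear.has_derivative[OF blinfun.bounded_linear_left f2])
  moreover have "partial_deriv k l f = (\<lambda>Y. f' Y (matrix_unit k l))" for k l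
    using partial_deriv_eq[OF f'] by blast
  ultimately have "partial_deriv i j (partial_deriv k l f) X = f2 (matrix_unit i j) (matrix_unit k l)"
    for i j k l
    by (simp add: partial_deriv_eq[OF entry])
  then have "hessian f X V $ i $ j = f2 (matrix_unit i j) V" for i j
    using blinfun_matrix_unit_sum[of V "f2 (matrix_unit i j)"]
    by (simp add: hessian_def mult.commute)
  then have "D \<bullet> hessian f X V = (\<Sum>i\<in>UNIV. \<Sum>j\<in>UNIV. D $ i $ j *\<^sub>R f2 (matrix_unit i j)) V"
    by (simp add: inner_vec_def blinfun.sum_left blinfun.scaleR_left)
  then show ?thesis by (simp add: blinfun_matrix_unit_sum)
qed

section \<open>Multipliers of the penalty\<close>

lemma phi_eq_halfspace_count: "phi A = halfspace_count (\<lambda>_. 1) A"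
  by (rule ext) (simp add: phi_def pos_count_def affine_map_def halfspace_count_def)

lemma feasible_cone_phi: "feasible_cone (\<lambda>_. 1) A X = {D. \<forall>i\<in>active_set A X. A i \<bullet> D \<le> 0}"
  by (auto simp: feasible_cone_def active_set_def affine_map_def)

text \<open>
  Here the feasible cone is a product of half-lines in the active coordinates and of whole lines in
  the others, so its polar can be read off by testing with coordinate vectors of both signs.
\<close>

lemma limiting_subdiff_pos_count:
  fixes y :: "real^'n::finite"
  shows "limiting_subdiff pos_count y = {z. \<forall>i. 0 \<le> z $ i \<and> (y $ i \<noteq> 0 \<longrightarrow> z $ i = 0)}"
proof -
  have count: "(pos_count :: real^'n \<Rightarrow> real) = halfspace_count (\<lambda>_. 0) (\<lambda>i. axis i 1)"
    by (rule ext) (simp add: pos_count_def halfspace_count_def inner_axis')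
  have *: "limiting_subdiff pos_count y = {z. \<forall>D\<in>{D :: real^'n. \<forall>i. y $ i = 0 \<longrightarrow> D $ i \<le> 0}. z \<bullet> D \<le> 0}"
    unfolding count limiting_subdiff_halfspace_count by (simp add: feasible_cone_def inner_axis')
  show ?thesis
    unfolding *
  proof safe
    fix z :: "real^'n" and i
    assume z: "\<forall>D\<in>{D :: real^'n. \<forall>i. y $ i = 0 \<longrightarrow> D $ i \<le> 0}. z \<bullet> D \<le> 0"
    have "z \<bullet> (- axis i 1) \<le> 0" by (intro z[rule_format]) (auto simp: axis_def)
    then show "0 \<le> z $ i" by (simp add: inner_axis)
    moreover assume "y $ i \<noteq> 0"
    then have "z \<bullet> axis i 1 \<le> 0" by (intro z[rule_format]) (auto simp: axis_def)
    ultimately show "z $ i = 0" by (simp add: inner_axis)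
  next
    fix z D :: "real^'n"
    assume z: "\<forall>i. 0 \<le> z $ i \<and> (y $ i \<noteq> 0 \<longrightarrow> z $ i = 0)" and D: "\<forall>i. y $ i = 0 \<longrightarrow> D $ i \<le> 0"
    have "z $ i * D $ i \<le> 0" for i
      using z D by (cases "y $ i = 0") (auto simp: mult_nonneg_nonpos)
    then show "z \<bullet> D \<le> 0" by (simp add: inner_vec_def sum_nonpos)
  qed
qed

lemma multipliers_iff:
  "z \<in> multipliers A X V \<longleftrightarrow>
    (\<forall>i. 0 \<le> z $ i \<and> (i \<notin> active_set A X \<longrightarrow> z $ i = 0)) \<and> (\<Sum>i\<in>active_set A X. z $ i *\<^sub>R A i) = V"
proof -
  have "adjoint_map A z = (\<Sum>i\<in>active_set A X. z $ i *\<^sub>R A i)"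
    if "\<forall>i. i \<notin> active_set A X \<longrightarrow> z $ i = 0"
    unfolding adjoint_map_def using that by (intro sum.mono_neutral_right) auto
  then show ?thesis
    by (auto simp: multipliers_def limiting_subdiff_pos_count active_set_def)
qed

section \<open>Optimality conditions\<close>

theorem mainTheorem2:
  fixes f :: "real^'p::finite^'m::finite \<Rightarrow> real"
    and A :: "'n::finite \<Rightarrow> real^'p^'m"
    and lam :: real
    and Xs :: "real^'p^'m"
  assumes "twice_continuously_differentiable f"
    and "lam > 0"
    and "\<And>z :: 'n \<Rightarrow> real.
      (\<forall>i\<in>active_set A Xs. z i \<ge> 0) \<Longrightarrow> (\<Sum>i\<in>active_set A Xs. z i *\<^sub>R A i) = 0 \<Longrightarrow>
      \<forall>i\<in>active_set A Xs. z i = 0"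
  shows "(local_minimizer (\<lambda>X. f X + lam * phi A X) Xs \<longrightarrow>
      0 \<in> limiting_subdiff (\<lambda>X. f X + lam * phi A X) Xs \<and>
      - gradient f Xs \<in> (\<lambda>V. lam *\<^sub>R V) ` limiting_subdiff (phi A) Xs \<and>
      (\<lambda>V. lam *\<^sub>R V) ` limiting_subdiff (phi A) Xs = limiting_subdiff (phi A) Xs \<and>
      (\<exists>z \<in> multipliers A Xs (- gradient f Xs).
        \<forall>D \<in> critical_directions A Xs z. D \<bullet> hessian f Xs D \<ge> 0))
    \<and>
    (0 \<in> limiting_subdiff (\<lambda>X. f X + lam * phi A X) Xs \<and>
      (\<exists>z \<in> multipliers A Xs (- gradient f Xs).
        \<forall>D \<in> critical_directions A Xs z - {0}. D \<bullet> hessian f Xs D > 0) \<longrightarrow>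
      local_minimizer (\<lambda>X. f X + lam * phi A X) Xs \<and>
      (\<exists>\<kappa>>0. \<exists>\<delta>>0. \<forall>X\<in>ball Xs \<delta>.
        f X + lam * pos_count (affine_map A X)
          \<ge> f Xs + lam * pos_count (affine_map A Xs) + \<kappa> * (norm (X - Xs))\<^sup>2))"
proof -
  obtain f' :: "real^'p^'m \<Rightarrow> (real^'p^'m) \<Rightarrow>\<^sub>L real" and f2
    where f': "\<And>X. (f has_derivative blinfun_apply (f' X)) (at X)"
      and f2: "\<And>X. (f' has_derivative blinfun_apply (f2 X)) (at X)"
    using assms(1) unfolding twice_continuously_differentiable_def by blast
  note grad = inner_gradient[OF f'] and hess = inner_hessian[OF f' f2]
  define K where "K = feasible_cone (\<lambda>_. 1) A Xs"
  have K: "D \<in> K \<longleftrightarrow> (\<forall>i\<in>active_set A Xs. A i \<bullet> D \<le> 0)" for D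
    by (simp add: K_def feasible_cone_phi)
  have subdiff: "limiting_subdiff (phi A) Xs = {v. \<forall>D\<in>K. v \<bullet> D \<le> 0}"
    by (simp add: phi_eq_halfspace_count limiting_subdiff_halfspace_count K_def)
  have multiplier_inner: "f' Xs D = - (\<Sum>i\<in>active_set A Xs. z $ i * (A i \<bullet> D))"
    if "z \<in> multipliers A Xs (- gradient f Xs)" for z D
  proof -
    have "gradient f Xs = - (\<Sum>i\<in>active_set A Xs. z $ i *\<^sub>R A i)"
      using that unfolding multipliers_iff by simp
    then show ?thesis
      using grad[of Xs D] by (simp add: inner_sum_left)
  qed
  have scale: "(\<lambda>V. lam *\<^sub>R V) ` limiting_subdiff (phi A) Xs = limiting_subdiff (phi A) Xs"
  proof -
    have "v \<in> (\<lambda>V. lam *\<^sub>R V) ` {v. \<forall>D\<in>K. v \<bullet> D \<le> 0}" if "\<forall>D\<in>K. v \<bullet> D \<le> 0" for v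
      using that \<open>lam > 0\<close>
      by (intro image_eqI[of _ _ "v /\<^sub>R lam"]) (auto simp: mult_nonneg_nonpos)
    then show ?thesis
      using \<open>lam > 0\<close> unfolding subdiff by (auto simp: mult_le_0_iff)
  qed
  show ?thesis
  proof (intro conjI impI)
    assume min: "local_minimizer (\<lambda>X. f X + lam * phi A X) Xs"
    then show "0 \<in> limiting_subdiff (\<lambda>X. f X + lam * phi A X) Xs"
      using local_minimizer_imp_zero_regular_subdiff regular_subdiff_subset_limiting_subdiff by blast
    have ray: "\<forall>\<^sub>F t in at_right 0. f Xs \<le> f (Xs + t *\<^sub>R D)" if "D \<in> K" for D
      using eventually_compose_filterlim[OF local_minimizer_eventually[OF min] tendsto_ray_at_right[of Xs D]]
        halfspace_count_ray[OF that[unfolded K_def]]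
      by eventually_elim (simp add: phi_eq_halfspace_count)
    then have first: "0 \<le> f' Xs D" if "D \<in> K" for D
      using first_order_necessary[OF f'] that by blast
    then have "- gradient f Xs \<in> limiting_subdiff (phi A) Xs"
      by (simp add: subdiff grad)
    with scale show "- gradient f Xs \<in> (\<lambda>V. lam *\<^sub>R V) ` limiting_subdiff (phi A) Xs" by simp
    show "(\<lambda>V. lam *\<^sub>R V) ` limiting_subdiff (phi A) Xs = limiting_subdiff (phi A) Xs"
      by (fact scale)
    obtain w where w: "\<And>i. i \<in> active_set A Xs \<Longrightarrow> 0 \<le> w i"
      "- gradient f Xs = (\<Sum>i\<in>active_set A Xs. w i *\<^sub>R A i)"
      using farkas_finite_family[of "active_set A Xs" A "- gradient f Xs"] first
      by (auto simp: grad K)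
    define z :: "real^'n" where "z = (\<chi> i. if i \<in> active_set A Xs then w i else 0)"
    have z: "z \<in> multipliers A Xs (- gradient f Xs)"
      using w by (simp add: multipliers_iff z_def)
    show "\<exists>z \<in> multipliers A Xs (- gradient f Xs).
        \<forall>D \<in> critical_directions A Xs z. D \<bullet> hessian f Xs D \<ge> 0"
    proof (intro bexI[OF _ z] ballI)
      fix D assume "D \<in> critical_directions A Xs z"
      then have D: "\<And>i. i \<in> active_set A Xs \<Longrightarrow> z $ i * (A i \<bullet> D) = 0" "D \<in> K"
        by (auto simp: critical_directions_def K inner_commute)
      have "f' Xs D = 0"
        by (simp add: multiplier_inner[OF z] D(1) sum.neutral)
      then show "D \<bullet> hessian f Xs D \<ge> 0"
        using second_order_necessary[OF f' f2 ray[OF D(2)]] by (simp add: hess)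
    qed
  next
    assume "0 \<in> limiting_subdiff (\<lambda>X. f X + lam * phi A X) Xs \<and>
      (\<exists>z \<in> multipliers A Xs (- gradient f Xs).
        \<forall>D \<in> critical_directions A Xs z - {0}. D \<bullet> hessian f Xs D > 0)"
    then obtain z where z: "z \<in> multipliers A Xs (- gradient f Xs)"
      and pos: "\<And>D. D \<in> critical_directions A Xs z \<Longrightarrow> D \<noteq> 0 \<Longrightarrow> D \<bullet> hessian f Xs D > 0"
      by blast
    have z_nonneg: "0 \<le> z $ i" for i using z by (simp add: multipliers_iff)
    have comp: "z $ i * (A i \<bullet> D) \<le> 0" if "D \<in> K" "i \<in> active_set A Xs" for D i
      using that z_nonneg by (simp add: K mult_nonneg_nonpos)
    have first: "0 \<le> f' Xs D" if "D \<in> K" for D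
      using comp[OF that] by (simp add: multiplier_inner[OF z] sum_nonpos)
    have second: "0 < f2 Xs D D" if "D \<in> K" "f' Xs D = 0" "D \<noteq> 0" for D
    proof -
      have "(\<Sum>i\<in>active_set A Xs. - (z $ i * (A i \<bullet> D))) = 0"
        using that(2) by (simp add: multiplier_inner[OF z] sum_negf)
      then have "\<forall>i\<in>active_set A Xs. - (z $ i * (A i \<bullet> D)) = 0"
        using comp[OF that(1)] by (subst (asm) sum_nonneg_eq_0_iff) auto
      then have "D \<in> critical_directions A Xs z"
        using that(1) z_nonneg by (auto simp: critical_directions_def K inner_commute)
      from pos[OF this that(3)] show ?thesis by (simp add: hess)
    qed
    obtain \<kappa> where "\<kappa> > 0"
      and feasible: "\<forall>\<^sub>F X in nhds Xs. X - Xs \<in> K \<longrightarrow> f Xs + \<kappa> * (norm (X - Xs))\<^sup>2 \<le> f X"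
      using second_order_growth_on_cone[OF f' f2 _ _ first second, of K]
        closed_feasible_cone feasible_cone_scaleR unfolding K_def by blast
    \<comment> \<open>off the cone the penalty rises by at least \<open>lam\<close>, so \<open>f\<close> minus the quadratic term may drop by almost \<open>lam\<close>\<close>
    have "((\<lambda>X. f X - \<kappa> * (norm (X - Xs))\<^sup>2) \<longlongrightarrow> f Xs - \<kappa> * (norm (Xs - Xs))\<^sup>2) (nhds Xs)"
      using has_derivative_continuous[OF f', of Xs]
      by (intro tendsto_intros filterlim_ident) (simp add: continuous_at tendsto_nhds_iff)
    then have "\<forall>\<^sub>F X in nhds Xs. f Xs - lam < f X - \<kappa> * (norm (X - Xs))\<^sup>2"
      by (rule order_tendstoD) (use \<open>lam > 0\<close> in simp)
    then have "\<forall>\<^sub>F X in nhds Xs.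
        f Xs + lam * phi A Xs + \<kappa> * (norm (X - Xs))\<^sup>2 \<le> f X + lam * phi A X"
      using feasible halfspace_count_near[of Xs "\<lambda>_. 1" A]
    proof eventually_elim
      case (elim X)
      show ?case
      proof (cases "X - Xs \<in> K")
        case True
        with elim show ?thesis by (simp add: phi_eq_halfspace_count K_def)
      next
        case False
        then have "phi A Xs + 1 \<le> phi A X"
          using elim by (simp add: phi_eq_halfspace_count K_def)
        then have "lam * (phi A Xs + 1) \<le> lam * phi A X"
          using \<open>lam > 0\<close> by (intro mult_left_mono) auto
        with elim(1) show ?thesis by (simp add: algebra_simps)
      qed
    qed
    then obtain \<delta> where "\<delta> > 0" and growth: "\<And>X. X \<in> ball Xs \<delta> \<Longrightarrow>
        f Xs + lam * phi A Xs + \<kappa> * (norm (X - Xs))\<^sup>2 \<le> f X + lam * phi A X"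
      unfolding eventually_nhds_metric by (auto simp: dist_commute)
    then show "\<exists>\<kappa>>0. \<exists>\<delta>>0. \<forall>X\<in>ball Xs \<delta>.
        f X + lam * pos_count (affine_map A X)
          \<ge> f Xs + lam * pos_count (affine_map A Xs) + \<kappa> * (norm (X - Xs))\<^sup>2"
      using \<open>\<kappa> > 0\<close> unfolding phi_def by blast
    have "f Xs + lam * phi A Xs \<le> f X + lam * phi A X" if "X \<in> ball Xs \<delta>" for X
      using growth[OF that] \<open>\<kappa> > 0\<close> by (smt (verit) mult_nonneg_nonneg zero_le_power2)
    with \<open>\<delta> > 0\<close> show "local_minimizer (\<lambda>X. f X + lam * phi A X) Xs"
      unfolding local_minimizer_def by blast
  qed
qed

end
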